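(* Let $X$ be a Hilbert space. Let $\Omega$ be an open subset of $X$ and let $u_0:\overline{\Omega}\to\mathbb{R}$ be a Lipschitz function such that $\mathrm{Lip}(u_0,\partial\Omega)<\mathrm{Lip}(u_0,\overline{\Omega})$. Given $\varepsilon>0$, there exists a function $v:\overline{\Omega}\to\mathbb{R}$ such that $v$ is of class $C^1(\Omega)$, $v$ is Lipschitz on $\overline{\Omega}$ with $\mathrm{Lip}(v,\overline{\Omega})\leq\mathrm{Lip}(u_0,\overline{\Omega})$, $v=u_0$ on $\partial\Omega$, and $|u_0-v|\leq\varepsilon$ on $\overline{\Omega}$.
   Context: All spaces are real; the Hilbert space is not assumed separable. For a metric space $(E,d)$ and $f:E\to\mathbb{R}$, $\mathrm{Lip}(f,E):=\inf\{L>0 : |f(x)-f(y)|\leq L\,d(x,y)\text{ for all }x,y\in E\}$; for a subset $S$ of the domain of $f$, $\mathrm{Lip}(f,S)$ means the Lipschitz constant of the restriction of $f$ to $S$ (with the distance induced by the norm of $X$). Smoothness is in the Fréchet sense. *)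

theory Defs
  imports "HOL-Analysis.Analysis"
begin

text \<open>
  The least Lipschitz constant of \<open>f\<close> on \<open>E\<close>. As an infimum of reals it is meaningful only when
  \<open>f\<close> is Lipschitz on \<open>E\<close>, where the set is nonempty. For \<open>E\<close> empty, the value is \<open>0\<close>.
\<close>

definition Lip :: "('a::metric_space \<Rightarrow> real) \<Rightarrow> 'a set \<Rightarrow> real" where
  "Lip f E = Inf {L. L > 0 \<and> (\<forall>x\<in>E. \<forall>y\<in>E. \<bar>f x - f y\<bar> \<le> L * dist x y)}"

text \<open>
  Class \<open>C\<^sup>1\<close> in the Frechet sense, for an open set \<open>S\<close>. The derivative is continuous into the space
  of bounded linear maps with the operator norm.
\<close>

definition C1_on :: "'a::real_normed_vector set \<Rightarrow> ('a \<Rightarrow> 'b::real_normed_vector) \<Rightarrow> bool" where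
  "C1_on S f \<longleftrightarrow>
     (\<exists>f' :: 'a \<Rightarrow> 'a \<Rightarrow>\<^sub>L 'b.
        (\<forall>x\<in>S. (f has_derivative blinfun_apply (f' x)) (at x)) \<and> continuous_on S f')"

end

theory Submission
  imports Defs
begin

text \<open>
  Let \<open>K\<close> be the Lipschitz constant of \<open>u\<^sub>0\<close> on the closure of \<open>\<Omega>\<close>, and \<open>K' < K\<close> the one on the
  frontier.

  The Hilbert structure provides smoothing without loss: the Lasry--Lions regularization
  approximates an \<open>L\<close>-Lipschitz function on the whole space uniformly by \<open>C\<^sup>1\<close> functions that are
  again \<open>L\<close>-Lipschitz (\<open>C1_lipschitz_approximation\<close>). This rests on the parallelogram identity, which
  controls second differences, and on the fact that a Lipschitz function whose second differences
  are \<open>O((norm h)\<^sup>2)\<close> is of class \<open>C\<^sup>1\<close> (\<open>has_derivative_second_difference\<close>).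

  To attain the boundary values, regularizations of increasing precision have to be glued as the
  boundary is approached, and the cutoff functions cost some of the Lipschitz constant. The room
  for this is made first. Both \<open>u\<^sub>0\<close> and its restriction to the frontier extend to the whole space, as
  \<open>U\<close> and \<open>w\<close> with constants \<open>K\<close> and \<open>K'\<close>. Truncating \<open>w\<close> between two slightly contracted copies of \<open>U\<close>
  yields a function \<open>u\<close> uniformly close to \<open>U\<close>, with the same frontier values, and with a Lipschitz
  constant smaller than \<open>K\<close> on every ball (\<open>locally_strict_lipschitz_perturbation\<close>). Here
  \<open>K' < K\<close> is essential: where \<open>w\<close> lies between the two copies, \<open>u\<close> is \<open>w\<close>.

  The gluing is over countably many bands that are bounded and stay away from the complement of
  \<open>\<Omega>\<close>, and on each of them the slack is bounded below (\<open>C1_smoothing_on_open\<close>). The result \<open>v\<close> has a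
  derivative of norm at most \<open>K\<close> on \<open>\<Omega>\<close>. Outside \<open>\<Omega>\<close> it equals \<open>u\<close>, and \<open>v - u\<close> vanishes to second
  order there. So at every point the pointwise Lipschitz constant of \<open>v\<close> is at most \<open>K\<close>, and on a normed
  space this makes \<open>v\<close> globally \<open>K\<close>-Lipschitz (\<open>lipschitz_on_UNIV_pointwise\<close>).
\<close>

section \<open>Lipschitz functions\<close>

lemma Lip_set_nonempty:
  assumes "C-lipschitz_on E f"
  shows "{L. L > 0 \<and> (\<forall>x\<in>E. \<forall>y\<in>E. \<bar>f x - f y\<bar> \<le> L * dist x y)} \<noteq> {}"
proof -
  have "\<bar>f x - f y\<bar> \<le> (C + 1) * dist x y" if "x \<in> E" "y \<in> E" for x y
    using lipschitz_onD[OF assms that]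
    by (simp add: dist_real_def distrib_right add.commute add_increasing)
  moreover have "C + 1 > 0"
    using lipschitz_on_nonneg[OF assms] by simp
  ultimately show ?thesis
    by blast
qed

lemma Lip_le:
  assumes "L > 0" "L-lipschitz_on E f"
  shows "Lip f E \<le> L"
  unfolding Lip_def
proof (rule cInf_lower)
  show "L \<in> {L. L > 0 \<and> (\<forall>x\<in>E. \<forall>y\<in>E. \<bar>f x - f y\<bar> \<le> L * dist x y)}"
    using assms by (auto simp: lipschitz_on_def dist_real_def)
  show "bdd_below {L. L > 0 \<and> (\<forall>x\<in>E. \<forall>y\<in>E. \<bar>f x - f y\<bar> \<le> L * dist x y)}"
    by (rule bdd_belowI[of _ 0]) auto
qed

lemma Lip_nonneg:
  assumes "C-lipschitz_on E f"
  shows "0 \<le> Lip f E"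
  unfolding Lip_def using Lip_set_nonempty[OF assms] by (intro cInf_greatest) auto

lemma lipschitz_on_Lip:
  assumes "C-lipschitz_on E f"
  shows "(Lip f E)-lipschitz_on E f"
proof (rule lipschitz_onI)
  show "0 \<le> Lip f E" by (rule Lip_nonneg[OF assms])
  fix x y assume xy: "x \<in> E" "y \<in> E"
  let ?S = "{L. L > 0 \<and> (\<forall>x\<in>E. \<forall>y\<in>E. \<bar>f x - f y\<bar> \<le> L * dist x y)}"
  show "dist (f x) (f y) \<le> Lip f E * dist x y"
  proof (cases "x = y")
    case False
    have "dist (f x) (f y) / dist x y \<le> Inf ?S"
      using Lip_set_nonempty[OF assms] xy False
      by (intro cInf_greatest) (auto simp: divide_le_eq dist_real_def)
    then show ?thesis
      using False by (simp add: Lip_def divide_le_eq)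
  qed simp
qed

text \<open>
  McShane's extension: the infimum of the cones \<open>u y + L * dist x y\<close> over \<open>y \<in> S\<close> is
  \<open>L\<close>-Lipschitz because each cone is, and the Lipschitz bound on \<open>S\<close> says exactly that over a
  point of \<open>S\<close> its own cone is the lowest.
\<close>

lemma lipschitz_extension:
  fixes u :: "'a::metric_space \<Rightarrow> real"
  assumes u: "L-lipschitz_on S u"
  obtains U where "L-lipschitz_on UNIV U" "\<And>x. x \<in> S \<Longrightarrow> U x = u x"
proof (cases "S = {}")
  case True
  have "L-lipschitz_on UNIV (\<lambda>x::'a. 0::real)"
    using lipschitz_on_nonneg[OF u] by (intro lipschitz_onI) auto
  then show ?thesis
    using True that by blast
next
  case False
  then obtain s where s: "s \<in> S" by blast
  have L: "0 \<le> L" by (rule lipschitz_on_nonneg[OF u])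
  define U where "U x = (INF y\<in>S. u y + L * dist x y)" for x
  have below: "u s - L * dist x s \<le> u y + L * dist x y" if "y \<in> S" for x y
  proof -
    have "u s - u y \<le> L * dist s y"
      using lipschitz_onD[OF u s that] by (simp add: dist_real_def)
    also have "\<dots> \<le> L * (dist x s + dist x y)"
      by (intro mult_left_mono L dist_triangle3)
    finally show ?thesis by (simp add: distrib_left)
  qed
  have bdd: "bdd_below ((\<lambda>y. u y + L * dist x y) ` S)" for x
    using below[of _ x] by (intro bdd_belowI2)
  have le: "U x \<le> U y + L * dist x y" for x y
  proof -
    have "U x - L * dist x y \<le> U y"
      unfolding U_def[of y]
    proof (rule cINF_greatest[OF False])
      fix z assume z: "z \<in> S"
      have "U x \<le> u z + L * dist x z"
        unfolding U_def by (rule cINF_lower[OF bdd z])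
      also have "\<dots> \<le> u z + L * (dist x y + dist y z)"
        by (intro add_left_mono mult_left_mono L dist_triangle)
      finally show "U x - L * dist x y \<le> u z + L * dist y z"
        by (simp add: distrib_left)
    qed
    then show ?thesis by simp
  qed
  have "L-lipschitz_on UNIV U"
  proof (rule lipschitz_onI[OF _ L])
    fix x y show "dist (U x) (U y) \<le> L * dist x y"
      using le[of x y] le[of y x] by (simp add: dist_real_def abs_le_iff dist_commute)
  qed
  moreover have "U x = u x" if x: "x \<in> S" for x
  proof (rule antisym)
    show "U x \<le> u x"
      unfolding U_def using cINF_lower[OF bdd x, of x] by simp
    show "u x \<le> U x"
      unfolding U_def
    proof (rule cINF_greatest[OF False])
      fix y assume "y \<in> S"
      then show "u x \<le> u y + L * dist x y"
        using lipschitz_onD[OF u x, of y] by (simp add: dist_real_def)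
    qed
  qed
  ultimately show ?thesis by (rule that)
qed

text \<open>
  Along the segment from \<open>x\<close> to \<open>y\<close> the bound with constant \<open>K + \<eta>\<close> is additive over adjacent
  intervals and holds on all short intervals around a given point, so bisection extends it to the
  whole segment. The hypothesis concerns one base point at a time. This is what allows points of
  an open set, where a derivative is available, and points outside it, where there is none, to be
  treated separately, with no need to follow how a segment crosses the boundary.
\<close>

lemma lipschitz_on_UNIV_pointwise:
  fixes f :: "'a::real_normed_vector \<Rightarrow> real"
  assumes K: "K \<ge> 0"
    and loc: "\<And>x \<eta>. \<eta> > 0 \<Longrightarrow>
      \<exists>d>0. \<forall>y. norm (y - x) < d \<longrightarrow> \<bar>f y - f x\<bar> \<le> (K + \<eta>) * norm (y - x)"
  shows "K-lipschitz_on UNIV f"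
proof (rule lipschitz_onI[OF _ K])
  fix x y :: 'a
  show "dist (f x) (f y) \<le> K * dist x y"
  proof (cases "x = y")
    case False
    define n where "n = norm (y - x)"
    have n: "n > 0" using False by (simp add: n_def)
    define \<gamma> where "\<gamma> t = x + t *\<^sub>R (y - x)" for t
    have g: "norm (\<gamma> s - \<gamma> t) = \<bar>s - t\<bar> * n" for s t
    proof -
      have "\<gamma> s - \<gamma> t = (s - t) *\<^sub>R (y - x)"
        by (simp add: \<gamma>_def algebra_simps)
      then show ?thesis by (simp add: n_def)
    qed
    have *: "\<bar>f y - f x\<bar> \<le> (K + \<eta>) * n" if \<eta>: "\<eta> > 0" for \<eta>
    proof -
      have "\<bar>f (\<gamma> 1) - f (\<gamma> 0)\<bar> \<le> (K + \<eta>) * n * (1 - 0)"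
      proof (rule Bolzano[of 0 1 "\<lambda>a b. \<bar>f (\<gamma> b) - f (\<gamma> a)\<bar> \<le> (K + \<eta>) * n * (b - a)"])
        fix a b c :: real
        assume "\<bar>f (\<gamma> b) - f (\<gamma> a)\<bar> \<le> (K + \<eta>) * n * (b - a)"
          "\<bar>f (\<gamma> c) - f (\<gamma> b)\<bar> \<le> (K + \<eta>) * n * (c - b)"
        then show "\<bar>f (\<gamma> c) - f (\<gamma> a)\<bar> \<le> (K + \<eta>) * n * (c - a)"
          by (simp add: right_diff_distrib)
      next
        fix t :: real
        obtain d where d: "d > 0"
          "\<And>z. norm (z - \<gamma> t) < d \<Longrightarrow> \<bar>f z - f (\<gamma> t)\<bar> \<le> (K + \<eta>) * norm (z - \<gamma> t)"
          using loc[OF \<eta>, of "\<gamma> t"] by blast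
        have "\<bar>f (\<gamma> b) - f (\<gamma> a)\<bar> \<le> (K + \<eta>) * n * (b - a)"
          if ab: "a \<le> t" "t \<le> b" "b - a < d / n" for a b
        proof -
          have "(b - a) * n < d" using ab n by (simp add: field_simps)
          moreover have "(b - t) * n \<le> (b - a) * n" "(t - a) * n \<le> (b - a) * n"
            using ab n by auto
          ultimately have "\<bar>f (\<gamma> b) - f (\<gamma> t)\<bar> \<le> (K + \<eta>) * ((b - t) * n)"
            "\<bar>f (\<gamma> a) - f (\<gamma> t)\<bar> \<le> (K + \<eta>) * ((t - a) * n)"
            using d(2)[of "\<gamma> b"] d(2)[of "\<gamma> a"] ab by (auto simp: g)
          moreover have "(K + \<eta>) * ((b - t) * n) + (K + \<eta>) * ((t - a) * n) = (K + \<eta>) * n * (b - a)"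
            by (simp add: algebra_simps)
          ultimately show ?thesis by linarith
        qed
        then show "\<exists>d>0. \<forall>a b. a \<le> t \<and> t \<le> b \<and> b - a < d \<longrightarrow>
            \<bar>f (\<gamma> b) - f (\<gamma> a)\<bar> \<le> (K + \<eta>) * n * (b - a)"
          using d(1) n by (intro exI[of _ "d / n"]) auto
      qed simp
      then show ?thesis by (simp add: \<gamma>_def)
    qed
    have "\<bar>f y - f x\<bar> / n \<le> K"
    proof (rule field_le_epsilon)
      fix e :: real assume "e > 0"
      then show "\<bar>f y - f x\<bar> / n \<le> K + e" using *[of e] n by (simp add: divide_le_eq)
    qed
    then have "\<bar>f y - f x\<bar> \<le> K * n" using n by (simp add: divide_le_eq)
    then show ?thesis
      by (simp add: n_def dist_real_def dist_norm norm_minus_commute abs_minus_commute)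
  qed simp
qed

section \<open>Differentiability from second differences\<close>

text \<open>
  Multiplying the defect \<open>D (r *\<^sub>R x) - r * D x\<close> by \<open>n\<close> and splitting off the integer part of
  \<open>n * r\<close> leaves a quantity bounded uniformly in \<open>n\<close>, so the defect is zero.
\<close>

lemma bounded_linear_additive:
  fixes D :: "'a::real_normed_vector \<Rightarrow> real"
  assumes add: "\<And>h k. D (h + k) = D h + D k"
    and bound: "\<And>h. \<bar>D h\<bar> \<le> L * norm h"
  shows "bounded_linear D"
proof (rule bounded_linear_intro[where K = L])
  interpret additive D by (rule additive.intro) (rule add)
  have nat: "D (real n *\<^sub>R x) = real n * D x" for n x
    by (induction n) (simp_all add: zero add algebra_simps)
  have int: "D (of_int m *\<^sub>R x) = of_int m * D x" for m x
    by (cases m rule: int_cases2) (simp_all add: nat minus)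
  fix r x
  show "D (r *\<^sub>R x) = r *\<^sub>R D x"
  proof (rule ccontr)
    assume "D (r *\<^sub>R x) \<noteq> r *\<^sub>R D x"
    then have pos: "\<bar>D (r *\<^sub>R x) - r * D x\<bar> > 0" by simp
    obtain n where n: "real n * \<bar>D (r *\<^sub>R x) - r * D x\<bar> > \<bar>L\<bar> * norm x + \<bar>D x\<bar>"
      using ex_less_of_nat_mult[OF pos] by blast
    define m where "m = \<lfloor>real n * r\<rfloor>"
    define q where "q = real n * r - of_int m"
    have q: "0 \<le> q" "q \<le> 1" unfolding q_def m_def by linarith+
    have nr: "real n * r = of_int m + q" by (simp add: q_def)
    have "real n * D (r *\<^sub>R x) = D ((of_int m + q) *\<^sub>R x)"
      by (simp add: nat[symmetric] nr)
    also have "\<dots> = of_int m * D x + D (q *\<^sub>R x)"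
      by (simp add: scaleR_add_left add int)
    finally have "real n * D (r *\<^sub>R x) - (real n * r) * D x = D (q *\<^sub>R x) - q * D x"
      by (simp add: nr distrib_right)
    then have "real n * (D (r *\<^sub>R x) - r * D x) = D (q *\<^sub>R x) - q * D x"
      by (simp add: right_diff_distrib)
    then have "real n * \<bar>D (r *\<^sub>R x) - r * D x\<bar> = \<bar>D (q *\<^sub>R x) - q * D x\<bar>"
      by (metis abs_mult abs_of_nat)
    also have "\<dots> \<le> \<bar>D (q *\<^sub>R x)\<bar> + \<bar>q * D x\<bar>" by simp
    also have "\<bar>D (q *\<^sub>R x)\<bar> \<le> L * norm (q *\<^sub>R x)" by (rule bound)
    also have "\<dots> \<le> \<bar>L\<bar> * norm x"
      using q by (simp add: mult_mono mult_left_le_one_le)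
    also have "\<bar>q * D x\<bar> \<le> \<bar>D x\<bar>"
      using q by (simp add: abs_mult mult_left_le_one_le)
    finally show False using n by simp
  qed
qed (use add bound in \<open>simp_all add: mult.commute\<close>)

text \<open>
  The dyadic difference quotients \<open>2 ^ n * (f (x + h / 2 ^ n) - f x)\<close> change by
  \<open>O((norm h)\<^sup>2 / 2 ^ n)\<close> from one \<open>n\<close> to the next, because the change is a second difference.
  Hence they converge, and the limit \<open>D x h\<close> satisfies \<open>f (x + h) - f x - D x h = O((norm h)\<^sup>2)\<close>.
  Additivity of \<open>D x\<close> comes from second differences around the centre of the parallelogram with
  vertices \<open>x\<close>, \<open>x + h\<close>, \<open>x + k\<close>, \<open>x + h + k\<close>, and boundedness from the Lipschitz condition. The
  quadratic error, uniform in \<open>x\<close>, also makes the derivative a Lipschitz function of \<open>x\<close>.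
\<close>

lemma has_derivative_second_difference:
  fixes f :: "'a::real_normed_vector \<Rightarrow> real"
  assumes lip: "L-lipschitz_on UNIV f"
    and sd: "\<And>x h. \<bar>f (x + h) + f (x - h) - 2 * f x\<bar> \<le> C * (norm h)\<^sup>2"
  obtains f' :: "'a \<Rightarrow> 'a \<Rightarrow>\<^sub>L real"
  where "\<And>x. (f has_derivative blinfun_apply (f' x)) (at x)"
    "continuous_on UNIV f'" "\<And>x. norm (f' x) \<le> L"
proof -
  have L: "0 \<le> L" by (rule lipschitz_on_nonneg[OF lip])
  have C: "0 \<le> C * (norm h)\<^sup>2" for h :: 'a using sd[of 0 h] by linarith
  define T where "T x h n = 2 ^ n * (f (x + (1 / 2 ^ n) *\<^sub>R h) - f x)" for x h n
  have T_step: "\<bar>T x h (Suc n) - T x h n\<bar> \<le> C * (norm h)\<^sup>2 / 4 * (1/2) ^ n" for x h n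
  proof -
    \<comment> \<open>The increment is a second difference at \<open>x + k\<close> with step \<open>k\<close>.\<close>
    define k where "k = (1 / 2 ^ Suc n) *\<^sub>R h"
    have eq: "(1 / 2 ^ n) *\<^sub>R h = k + k"
      by (simp add: k_def flip: scaleR_left.add)
    have "T x h (Suc n) - T x h n = - (2 ^ n * (f (x + k + k) + f (x + k - k) - 2 * f (x + k)))"
      unfolding T_def eq k_def[symmetric] by (simp add: algebra_simps)
    then have "\<bar>T x h (Suc n) - T x h n\<bar> \<le> 2 ^ n * (C * (norm k)\<^sup>2)"
      using sd[of "x + k" k] by (simp add: abs_mult)
    also have "\<dots> = C * (norm h)\<^sup>2 / 4 * (1/2) ^ n"
      by (simp add: k_def power_mult_distrib power_divide power2_eq_square)
    finally show ?thesis .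
  qed
  have T_diff: "\<bar>T x h n - T x h 0\<bar> \<le> C * (norm h)\<^sup>2 / 2 * (1 - (1/2) ^ n)" for x h n
  proof (induction n)
    case (Suc n)
    have "C * (norm h)\<^sup>2 / 2 * (1 - (1/2) ^ n) + C * (norm h)\<^sup>2 / 4 * (1/2) ^ n
        = C * (norm h)\<^sup>2 / 2 * (1 - (1/2) ^ Suc n)"
      by (simp add: right_diff_distrib)
    then show ?case using Suc T_step[of x h n] by linarith
  qed simp
  define D where "D x h = lim (T x h)" for x h
  have T_lim: "T x h \<longlonglongrightarrow> D x h" for x h
  proof -
    have "summable (\<lambda>n. T x h (Suc n) - T x h n)"
      by (rule summable_comparison_test'[where N = 0 and g = "\<lambda>n. C * (norm h)\<^sup>2 / 4 * (1/2) ^ n"])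
        (use T_step in \<open>auto intro!: summable_mult summable_geometric\<close>)
    from summable_LIMSEQ[OF this]
    have "(\<lambda>n. (T x h n - T x h 0) + T x h 0)
        \<longlonglongrightarrow> (\<Sum>n. T x h (Suc n) - T x h n) + T x h 0"
      unfolding sum_lessThan_telescope by (intro tendsto_add tendsto_const)
    then show ?thesis
      unfolding D_def by (auto intro: limI simp: convergent_LIMSEQ_iff[symmetric] convergent_def)
  qed
  have D_bound: "\<bar>D x h\<bar> \<le> L * norm h" for x h
  proof (rule LIMSEQ_le_const2[OF tendsto_rabs[OF T_lim]])
    have "\<bar>T x h n\<bar> \<le> L * norm h" for n
    proof -
      have "\<bar>T x h n\<bar> = 2 ^ n * \<bar>f (x + (1 / 2 ^ n) *\<^sub>R h) - f x\<bar>"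
        unfolding T_def abs_mult by simp
      also have "\<dots> \<le> 2 ^ n * (L * norm ((1 / 2 ^ n) *\<^sub>R h))"
        using lipschitz_onD[OF lip, of "x + (1 / 2 ^ n) *\<^sub>R h" x]
        by (intro mult_left_mono) (simp_all add: dist_real_def dist_norm)
      finally show ?thesis by simp
    qed
    then show "\<exists>N. \<forall>n\<ge>N. \<bar>T x h n\<bar> \<le> L * norm h" by blast
  qed
  have D_est: "\<bar>f (x + h) - f x - D x h\<bar> \<le> C * (norm h)\<^sup>2" for x h
  proof -
    have "\<bar>D x h - T x h 0\<bar> \<le> C * (norm h)\<^sup>2"
    proof (rule LIMSEQ_le_const2[OF tendsto_rabs[OF tendsto_diff[OF T_lim tendsto_const]]])
      have "\<bar>T x h n - T x h 0\<bar> \<le> C * (norm h)\<^sup>2" for n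
      proof -
        have "C * (norm h)\<^sup>2 / 2 * (1 - (1/2) ^ n) \<le> C * (norm h)\<^sup>2 * 1"
          using C[of h] by (intro mult_mono) (simp_all add: power_le_one)
        then show ?thesis using T_diff[of x h n] by linarith
      qed
      then show "\<exists>N. \<forall>n\<ge>N. \<bar>T x h n - T x h 0\<bar> \<le> C * (norm h)\<^sup>2" by blast
    qed
    then show ?thesis by (simp add: T_def abs_minus_commute)
  qed
  have D_add: "D x (h + k) = D x h + D x k" for x h k
  proof -
    define B where "B = C * (norm (h - k))\<^sup>2 / 4 + C * (norm (h + k))\<^sup>2 / 4"
    have est: "\<bar>f (x + s *\<^sub>R h) + f (x + s *\<^sub>R k) - f (x + s *\<^sub>R (h + k)) - f x\<bar> \<le> s\<^sup>2 * B" for s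
    proof -
      define m where "m = x + (s / 2) *\<^sub>R (h + k)"
      have e: "m + (s / 2) *\<^sub>R (h - k) = x + s *\<^sub>R h" "m - (s / 2) *\<^sub>R (h - k) = x + s *\<^sub>R k"
        "m + (s / 2) *\<^sub>R (h + k) = x + s *\<^sub>R (h + k)" "m - (s / 2) *\<^sub>R (h + k) = x"
        by (simp_all add: m_def scaleR_add_right scaleR_diff_right flip: scaleR_left.add)
           (simp_all add: add.commute add.left_commute flip: scaleR_left.add)
      have "s\<^sup>2 * B = C * (norm ((s / 2) *\<^sub>R (h - k)))\<^sup>2 + C * (norm ((s / 2) *\<^sub>R (h + k)))\<^sup>2"
        unfolding B_def norm_scaleR power_mult_distrib
        by (simp add: power_divide distrib_left mult.left_commute)
      then show ?thesis
        using sd[of m "(s / 2) *\<^sub>R (h - k)"] sd[of m "(s / 2) *\<^sub>R (h + k)"]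
        unfolding e by linarith
    qed
    have "(\<lambda>n. T x h n + T x k n - T x (h + k) n) \<longlonglongrightarrow> 0"
    proof (rule tendsto_0_le[where K = 1])
      show "(\<lambda>n. B * (1/2) ^ n) \<longlonglongrightarrow> 0"
        by (intro tendsto_mult_right_zero LIMSEQ_realpow_zero) auto
      have "norm (T x h n + T x k n - T x (h + k) n) \<le> norm (B * (1/2) ^ n) * 1" for n
      proof -
        have "T x h n + T x k n - T x (h + k) n
            = 2 ^ n * (f (x + (1 / 2 ^ n) *\<^sub>R h) + f (x + (1 / 2 ^ n) *\<^sub>R k)
                - f (x + (1 / 2 ^ n) *\<^sub>R (h + k)) - f x)"
          by (simp add: T_def algebra_simps)
        then have "\<bar>T x h n + T x k n - T x (h + k) n\<bar> \<le> 2 ^ n * ((1 / 2 ^ n)\<^sup>2 * B)"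
          using est[of "1 / 2 ^ n"] by (simp add: abs_mult)
        also have "\<dots> = B * (1/2) ^ n" by (simp add: power2_eq_square power_divide)
        finally show ?thesis by simp
      qed
      then show "\<forall>\<^sub>F n in sequentially.
          norm (T x h n + T x k n - T x (h + k) n) \<le> norm (B * (1/2) ^ n) * 1" by simp
    qed
    moreover have "(\<lambda>n. T x h n + T x k n - T x (h + k) n) \<longlonglongrightarrow> D x h + D x k - D x (h + k)"
      by (intro tendsto_intros T_lim)
    ultimately show ?thesis using LIMSEQ_unique by fastforce
  qed
  define f' where "f' x = Blinfun (D x)" for x
  have bl: "bounded_linear (D x)" for x
    by (rule bounded_linear_additive[OF D_add D_bound])
  have f': "blinfun_apply (f' x) = D x" for x
    by (simp add: f'_def bounded_linear_Blinfun_apply[OF bl])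
  have deriv: "(f has_derivative blinfun_apply (f' x)) (at x)" for x
    unfolding has_derivative_at_alt f'
  proof (intro conjI allI impI bl)
    fix e :: real assume e: "e > 0"
    have "norm (f y - f x - D x (y - x)) \<le> e * norm (y - x)"
      if y: "norm (y - x) < e / (\<bar>C\<bar> + 1)" for y
    proof -
      have "norm (f y - f x - D x (y - x)) \<le> C * (norm (y - x))\<^sup>2"
        using D_est[of x "y - x"] by simp
      also have "\<dots> \<le> ((\<bar>C\<bar> + 1) * norm (y - x)) * norm (y - x)"
        by (simp add: power2_eq_square mult_right_mono flip: mult.assoc)
      also have "\<dots> \<le> e * norm (y - x)"
        using y by (intro mult_right_mono) (simp_all add: field_simps)
      finally show ?thesis .
    qed
    then show "\<exists>d>0. \<forall>y. norm (y - x) < d \<longrightarrow> norm (f y - f x - D x (y - x)) \<le> e * norm (y - x)"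
      using e by (intro exI[of _ "e / (\<bar>C\<bar> + 1)"]) auto
  qed
  have lip': "norm (f' y - f' x) \<le> 6 * C * norm (y - x)" for x y
  proof (cases "y = x")
    case False
    define k where "k = y - x"
    have k: "norm k > 0" using False by (simp add: k_def)
    have Cpos: "0 \<le> C" using C[of k] k by (simp add: zero_le_mult_iff)
    \<comment> \<open>Compare the first-order expansions of \<open>f (x + k + h)\<close> at \<open>x\<close> and, via \<open>y = x + k\<close>, at \<open>y\<close>.
      All errors are multiples of \<open>(norm k)\<^sup>2\<close> when \<open>h\<close> is as long as \<open>k\<close>. Other \<open>h\<close> follow by scaling.\<close>
    have same: "\<bar>D y h - D x h\<bar> \<le> 6 * C * norm k * norm h" if h: "norm h = norm k" for h
    proof -
      have "norm (k + h) \<le> 2 * norm k" using norm_triangle_ineq[of k h] h by simp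
      then have "(norm (k + h))\<^sup>2 \<le> (2 * norm k)\<^sup>2" by (intro power_mono) auto
      then have "C * (norm (k + h))\<^sup>2 \<le> C * (2 * norm k)\<^sup>2" using Cpos by (rule mult_left_mono)
      moreover have "\<bar>f (x + (k + h)) - f x - D x (k + h)\<bar> \<le> C * (norm (k + h))\<^sup>2"
        "\<bar>f (x + k) - f x - D x k\<bar> \<le> C * (norm k)\<^sup>2"
        "\<bar>f (y + h) - f y - D y h\<bar> \<le> C * (norm k)\<^sup>2"
        using D_est[of x "k + h"] D_est[of x k] D_est[of y h] h by auto
      moreover have "f (y + h) = f (x + (k + h))" "f y = f (x + k)" by (simp_all add: k_def)
      moreover have "C * (2 * norm k)\<^sup>2 + C * (norm k)\<^sup>2 + C * (norm k)\<^sup>2 = 6 * C * norm k * norm h"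
        using h by (simp add: power2_eq_square)
      ultimately show ?thesis using D_add[of x k h] by linarith
    qed
    have "norm (blinfun_apply (f' y - f' x) h) \<le> 6 * C * norm k * norm h" for h
    proof (cases "h = 0")
      case h0: False
      define c where "c = norm k / norm h"
      have c: "c > 0" using k h0 by (simp add: c_def)
      have "c * \<bar>D y h - D x h\<bar> = \<bar>D y (c *\<^sub>R h) - D x (c *\<^sub>R h)\<bar>"
        using c by (simp add: linear_cmul[OF bounded_linear.linear[OF bl]] abs_mult
            flip: right_diff_distrib)
      also have "\<dots> \<le> 6 * C * norm k * norm (c *\<^sub>R h)"
        by (rule same) (use h0 c in \<open>simp add: c_def\<close>)
      also have "\<dots> = c * (6 * C * norm k * norm h)"
        using c by simp
      finally have "c * \<bar>D y h - D x h\<bar> \<le> c * (6 * C * norm k * norm h)" .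
      then show ?thesis using c by (simp add: f' blinfun.diff_left)
    qed simp
    then show ?thesis using Cpos by (simp add: norm_blinfun_bound k_def)
  qed simp
  have "continuous_on UNIV f'"
  proof (rule lipschitz_on_continuous_on[where L = "6 * \<bar>C\<bar>"], rule lipschitz_onI)
    fix x y :: 'a
    have "6 * C * norm (x - y) \<le> 6 * \<bar>C\<bar> * norm (x - y)" by (intro mult_right_mono) auto
    then show "dist (f' x) (f' y) \<le> 6 * \<bar>C\<bar> * dist x y"
      using lip'[of x y] by (simp add: dist_norm)
  qed simp
  moreover have "norm (f' x) \<le> L" for x
    by (rule norm_blinfun_bound[OF L]) (simp add: f' D_bound)
  ultimately show thesis using deriv that by blast
qed

section \<open>Regularization in inner product spaces\<close>

lemma parallelogram:
  fixes s r :: "'a::real_inner"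
  shows "(norm (s + r))\<^sup>2 + (norm (s - r))\<^sup>2 = 2 * (norm s)\<^sup>2 + 2 * (norm r)\<^sup>2"
  by (simp add: power2_norm_eq_inner algebra_simps inner_commute)

text \<open>
  The infimal convolution of \<open>u\<close> with \<open>a * (norm z)\<^sup>2\<close>, also known as the Moreau envelope. The
  infimum runs over the displacement \<open>z\<close>, so that it is visibly an infimum of translates of \<open>u\<close>.
\<close>

definition inf_conv :: "real \<Rightarrow> ('a::real_inner \<Rightarrow> real) \<Rightarrow> 'a \<Rightarrow> real" where
  "inf_conv a u x = (INF z. u (x - z) + a * (norm z)\<^sup>2)"

context
  fixes a L :: real and u :: "'a::real_inner \<Rightarrow> real"
  assumes a: "a > 0" and u: "L-lipschitz_on UNIV u"
begin

lemma inf_conv_integrand_lower: "u x - L\<^sup>2 / (4 * a) \<le> u (x - z) + a * (norm z)\<^sup>2"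
proof -
  have "u x - u (x - z) \<le> L * norm z"
    using lipschitz_onD[OF u, of x "x - z"] by (simp add: dist_real_def dist_norm)
  moreover have "0 \<le> (2 * a * norm z - L)\<^sup>2 / (4 * a)" using a by simp
  moreover have "(2 * a * norm z - L)\<^sup>2 / (4 * a) = a * (norm z)\<^sup>2 - L * norm z + L\<^sup>2 / (4 * a)"
    using a by (simp add: power2_eq_square field_simps)
  ultimately show ?thesis by linarith
qed

lemma inf_conv_lower: "u x - L\<^sup>2 / (4 * a) \<le> inf_conv a u x"
  unfolding inf_conv_def by (rule cINF_greatest) (auto intro: inf_conv_integrand_lower)

lemma inf_conv_le: "inf_conv a u x \<le> u (x - z) + a * (norm z)\<^sup>2"
  unfolding inf_conv_def
  by (rule cINF_lower) (rule bdd_belowI2[OF inf_conv_integrand_lower], simp)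

lemma inf_conv_upper: "inf_conv a u x \<le> u x"
  using inf_conv_le[of x 0] by simp

lemma inf_conv_geI: "(\<And>z. c \<le> u (x - z) + a * (norm z)\<^sup>2) \<Longrightarrow> c \<le> inf_conv a u x"
  unfolding inf_conv_def by (rule cINF_greatest) auto

lemma lipschitz_on_inf_conv: "L-lipschitz_on UNIV (inf_conv a u)"
proof -
  have le: "inf_conv a u x \<le> inf_conv a u y + L * dist x y" for x y
  proof -
    have "inf_conv a u x - L * dist x y \<le> inf_conv a u y"
    proof (rule inf_conv_geI)
      fix z
      have "u (x - z) - u (y - z) \<le> L * dist x y"
        using lipschitz_onD[OF u, of "x - z" "y - z"] by (simp add: dist_real_def dist_norm)
      then show "inf_conv a u x - L * dist x y \<le> u (y - z) + a * (norm z)\<^sup>2"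
        using inf_conv_le[of x z] by linarith
    qed
    then show ?thesis by linarith
  qed
  show ?thesis
  proof (rule lipschitz_onI)
    fix x y show "dist (inf_conv a u x) (inf_conv a u y) \<le> L * dist x y"
      using le[of x y] le[of y x] by (simp add: dist_real_def abs_le_iff dist_commute)
  qed (rule lipschitz_on_nonneg[OF u])
qed

text \<open>
  Semiconcavity: if \<open>z\<close> nearly attains the infimum at \<open>x\<close>, then \<open>z \<plusminus> h\<close> are admissible at
  \<open>x \<plusminus> h\<close>, where \<open>u\<close> is evaluated at the same point, and only the quadratic terms differ.
\<close>

lemma inf_conv_semiconcave:
  "inf_conv a u (x + h) + inf_conv a u (x - h) \<le> 2 * inf_conv a u x + 2 * a * (norm h)\<^sup>2"
proof -
  have "(inf_conv a u (x + h) + inf_conv a u (x - h) - 2 * a * (norm h)\<^sup>2) / 2 \<le> inf_conv a u x"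
  proof (rule inf_conv_geI)
    fix z
    have "inf_conv a u (x + h) \<le> u (x - z) + a * (norm (z + h))\<^sup>2"
      "inf_conv a u (x - h) \<le> u (x - z) + a * (norm (z - h))\<^sup>2"
      using inf_conv_le[of "x + h" "z + h"] inf_conv_le[of "x - h" "z - h"] by simp_all
    moreover have "a * (norm (z + h))\<^sup>2 + a * (norm (z - h))\<^sup>2 = 2 * (a * (norm z)\<^sup>2) + 2 * a * (norm h)\<^sup>2"
      using arg_cong[OF parallelogram[of z h], of "(*) a"] by (simp add: distrib_left)
    ultimately show "(inf_conv a u (x + h) + inf_conv a u (x - h) - 2 * a * (norm h)\<^sup>2) / 2
        \<le> u (x - z) + a * (norm z)\<^sup>2" by (simp add: field_simps)
  qed
  then show ?thesis by (simp add: field_simps)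
qed

text \<open>
  A lower bound on second differences survives infimal convolution, at the price of a factor
  \<open>2\<close>, provided that the quadratic weight matches the semiconvexity constant. For displacements \<open>y\<close>
  and \<open>z\<close> at \<open>x \<plusminus> h\<close>, the half sum \<open>s\<close> is admissible at \<open>x\<close>. The half difference \<open>r\<close> costs
  \<open>a * (norm (h - r))\<^sup>2\<close> through \<open>u\<close> but gains \<open>2 * a * (norm r)\<^sup>2\<close> in the penalty.
\<close>

lemma inf_conv_semiconvex:
  assumes sc: "\<And>m k. 2 * u m - a * (norm k)\<^sup>2 \<le> u (m + k) + u (m - k)"
  shows "2 * inf_conv a u x - 2 * a * (norm h)\<^sup>2 \<le> inf_conv a u (x + h) + inf_conv a u (x - h)"
proof -
  have main: "2 * inf_conv a u x - 2 * a * (norm h)\<^sup>2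
      \<le> (u (x + h - y) + a * (norm y)\<^sup>2) + (u (x - h - z) + a * (norm z)\<^sup>2)" for y z
  proof -
    define s r where "s = (1/2) *\<^sub>R (y + z)" and "r = (1/2) *\<^sub>R (y - z)"
    have yz: "y = s + r" "z = s - r"
      by (simp_all add: s_def r_def algebra_simps flip: scaleR_left.add)
    have "u ((x - s) + (h - r)) + u ((x - s) - (h - r)) \<ge> 2 * u (x - s) - a * (norm (h - r))\<^sup>2"
      using sc[where m = "x - s" and k = "h - r"] by linarith
    moreover have "(x - s) + (h - r) = x + h - y" "(x - s) - (h - r) = x - h - z"
      by (simp_all add: yz)
    moreover have "a * (norm (h - r))\<^sup>2 \<le> a * (2 * (norm h)\<^sup>2 + 2 * (norm r)\<^sup>2)"
    proof (rule mult_left_mono)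
      show "(norm (h - r))\<^sup>2 \<le> 2 * (norm h)\<^sup>2 + 2 * (norm r)\<^sup>2"
        using parallelogram[of h r] zero_le_power2[of "norm (h + r)"] by linarith
    qed (use a in simp)
    moreover have "a * (norm y)\<^sup>2 + a * (norm z)\<^sup>2 = a * (2 * (norm s)\<^sup>2 + 2 * (norm r)\<^sup>2)"
      unfolding yz using parallelogram[of s r] by (metis distrib_left)
    ultimately show ?thesis
      using inf_conv_le[of x s] by (simp add: distrib_left)
  qed
  have "2 * inf_conv a u x - 2 * a * (norm h)\<^sup>2 - inf_conv a u (x - h) \<le> inf_conv a u (x + h)"
  proof (rule inf_conv_geI)
    fix y
    have "2 * inf_conv a u x - 2 * a * (norm h)\<^sup>2 - (u (x + h - y) + a * (norm y)\<^sup>2) \<le> inf_conv a u (x - h)"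
    proof (rule inf_conv_geI)
      fix z
      show "2 * inf_conv a u x - 2 * a * (norm h)\<^sup>2 - (u (x + h - y) + a * (norm y)\<^sup>2)
          \<le> u (x - h - z) + a * (norm z)\<^sup>2"
        using main[of y z] by linarith
    qed
    then show "2 * inf_conv a u x - 2 * a * (norm h)\<^sup>2 - inf_conv a u (x - h) \<le> u (x + h - y) + a * (norm y)\<^sup>2"
      by linarith
  qed
  then show ?thesis by linarith
qed

end

text \<open>
  The Lasry--Lions regularization: an infimal convolution makes the function semiconcave, and
  a supremal convolution (an infimal one conjugated by negation) with twice the weight makes it
  semiconvex while keeping it semiconcave. Both operations preserve the Lipschitz constant
  exactly, and a large weight makes the error small.
\<close>

lemma C1_lipschitz_approximation:
  fixes u :: "'a::real_inner \<Rightarrow> real"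
  assumes u: "L-lipschitz_on UNIV u" and \<delta>: "\<delta> > 0"
  obtains v :: "'a \<Rightarrow> real" and v' :: "'a \<Rightarrow> 'a \<Rightarrow>\<^sub>L real"
  where "\<And>x. (v has_derivative blinfun_apply (v' x)) (at x)"
    "continuous_on UNIV v'" "\<And>x. norm (v' x) \<le> L" "\<And>x. \<bar>v x - u x\<bar> \<le> \<delta>"
proof -
  \<comment> \<open>The \<open>+ 1\<close> only keeps \<open>a\<close> positive when \<open>L = 0\<close>.\<close>
  define a where "a = (L\<^sup>2 + 1) / (4 * \<delta>)"
  have a: "a > 0" using \<delta> by (simp add: a_def add_nonneg_pos)
  have err: "L\<^sup>2 / (4 * a) \<le> \<delta>"
  proof -
    have "4 * a = (L\<^sup>2 + 1) / \<delta>" using \<delta> by (simp add: a_def field_simps)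
    then have "L\<^sup>2 / (4 * a) = \<delta> * (L\<^sup>2 / (L\<^sup>2 + 1))" by simp
    also have "\<dots> \<le> \<delta> * 1"
      using \<delta> by (intro mult_left_mono) (auto simp: divide_le_eq add_nonneg_pos)
    finally show ?thesis by simp
  qed
  have err2: "L\<^sup>2 / (4 * (2 * a)) \<le> L\<^sup>2 / (4 * a)"
    using a by (intro divide_left_mono) auto
  define g where "g x = - inf_conv a u x" for x
  have g: "L-lipschitz_on UNIV g"
    unfolding g_def using lipschitz_on_inf_conv[OF a u] by simp
  define w where "w x = - inf_conv (2 * a) g x" for x
  have a2: "2 * a > 0" using a by simp
  have w: "L-lipschitz_on UNIV w"
    unfolding w_def using lipschitz_on_inf_conv[OF a2 g] by simp
  have sc: "2 * g m - 2 * a * (norm k)\<^sup>2 \<le> g (m + k) + g (m - k)" for m k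
    using inf_conv_semiconcave[OF a u, where x = m and h = k] by (simp add: g_def)
  have "\<bar>w (x + h) + w (x - h) - 2 * w x\<bar> \<le> 4 * a * (norm h)\<^sup>2" for x h
    using inf_conv_semiconcave[OF a2 g, where x = x and h = h] inf_conv_semiconvex[OF a2 g sc, where x = x and h = h]
    by (simp add: w_def abs_le_iff)
  from has_derivative_second_difference[OF w this]
  obtain w' :: "'a \<Rightarrow> 'a \<Rightarrow>\<^sub>L real" where w': "\<And>x. (w has_derivative blinfun_apply (w' x)) (at x)"
    "continuous_on UNIV w'" "\<And>x. norm (w' x) \<le> L" by blast
  have "\<bar>w x - u x\<bar> \<le> \<delta>" for x
    using inf_conv_lower[OF a u, of x] inf_conv_upper[OF a u, of x] err err2
      inf_conv_lower[OF a2 g, of x] inf_conv_upper[OF a2 g, of x]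
    unfolding w_def g_def by linarith
  with w' show thesis by (rule that)
qed

section \<open>Smooth cutoff functions\<close>

lemma DERIV_max0_power2: "((\<lambda>t::real. (max 0 t)\<^sup>2) has_real_derivative 2 * max 0 t) (at t)"
proof (cases "t = 0")
  case False
  then consider "t > 0" | "t < 0" by linarith
  then show ?thesis
  proof cases
    case 1
    have "((\<lambda>t. t\<^sup>2) has_real_derivative 2 * max 0 t) (at t)"
      using 1 by (auto intro!: derivative_eq_intros)
    then show ?thesis
      by (rule has_field_derivative_transform_within_open[of _ _ _ "{0<..}"]) (use 1 in auto)
  next
    case 2
    have "((\<lambda>t. 0) has_real_derivative 2 * max 0 t) (at t)"
      using 2 by (auto intro!: derivative_eq_intros)
    then show ?thesis
      by (rule has_field_derivative_transform_within_open[of _ _ _ "{..<0}"]) (use 2 in auto)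
  qed
next
  case True
  have "((\<lambda>h::real. ((max 0 h)\<^sup>2 - (max 0 0)\<^sup>2) / h) \<longlongrightarrow> 0) (at 0)"
  proof (rule Lim_null_comparison)
    show "\<forall>\<^sub>F h in at 0. norm (((max 0 h)\<^sup>2 - (max 0 0)\<^sup>2) / h) \<le> \<bar>h::real\<bar>"
      by (rule always_eventually) (auto simp: max_def power2_eq_square)
    show "((\<lambda>h::real. \<bar>h\<bar>) \<longlongrightarrow> 0) (at 0)"
      by (intro tendsto_rabs_zero tendsto_ident_at)
  qed
  then show ?thesis using True by (simp add: DERIV_def)
qed

text \<open>
  A \<open>C\<^sup>1\<close> step that is constant on both sides of the unit interval. The function
  \<open>t \<mapsto> (max 0 t)\<^sup>2\<close> is flat on one side; applying it twice, with a reflection in between, makes the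
  result flat on both sides.
\<close>

definition step :: "real \<Rightarrow> real" where
  "step t = 1 - (max 0 (1 - (max 0 t)\<^sup>2))\<^sup>2"

definition step' :: "real \<Rightarrow> real" where
  "step' t = 4 * max 0 (1 - (max 0 t)\<^sup>2) * max 0 t"

lemma step_deriv: "(step has_real_derivative step' t) (at t)"
  unfolding step_def[abs_def] step'_def
  by (rule derivative_eq_intros DERIV_chain2[OF DERIV_max0_power2] DERIV_max0_power2 refl
      | simp)+

lemma step_range: "0 \<le> step t" "step t \<le> 1"
  by (auto simp: step_def intro!: power_le_one)

lemma step_le_0: "t \<le> 0 \<Longrightarrow> step t = 0"
  by (simp add: step_def)

lemma step_ge_1:
  assumes "t \<ge> 1"
  shows "step t = 1" "step' t = 0"
proof -
  have "max 0 (1 - (max 0 t)\<^sup>2) = 0" using assms by simp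
  then show "step t = 1" "step' t = 0" by (simp_all add: step_def step'_def)
qed

lemma step'_le_0: "t \<le> 0 \<Longrightarrow> step' t = 0"
  by (simp add: step'_def)

lemma step'_bound: "\<bar>step' t\<bar> \<le> 4"
proof (cases "t \<le> 0 \<or> t \<ge> 1")
  case True
  then show ?thesis using step'_le_0[of t] step_ge_1(2)[of t] by fastforce
next
  case False
  then have "t\<^sup>2 \<le> 1" by (simp add: power_le_one)
  then have "max 0 (1 - (max 0 t)\<^sup>2) * max 0 t \<le> 1 * 1"
    using False by (intro mult_mono) auto
  then show ?thesis by (simp add: step'_def abs_mult)
qed

lemma continuous_on_step': "continuous_on A step'"
  unfolding step'_def[abs_def] by (intro continuous_intros)

text \<open>
  The step applied to a \<open>C\<^sup>1\<close> approximation of \<open>e\<close>. The approximation error \<open>\<delta>\<close> is a quarter of the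
  gap \<open>\<beta> - \<alpha>\<close>, so the step, which acts on approximate values between \<open>\<alpha> + \<delta>\<close> and \<open>\<beta> - \<delta>\<close>, is already flat
  where \<open>e \<le> \<alpha>\<close> or \<open>e \<ge> \<beta>\<close>.
\<close>

lemma C1_cutoff:
  fixes e :: "'a::real_inner \<Rightarrow> real"
  assumes e: "L-lipschitz_on UNIV e" and \<alpha>\<beta>: "\<alpha> < \<beta>"
  obtains s :: "'a \<Rightarrow> real" and s' :: "'a \<Rightarrow> 'a \<Rightarrow>\<^sub>L real" and M :: real
  where "\<And>x. (s has_derivative blinfun_apply (s' x)) (at x)"
    "continuous_on UNIV s'" "M > 0" "\<And>x. norm (s' x) \<le> M" "\<And>x. 0 \<le> s x" "\<And>x. s x \<le> 1"
    "\<And>x. e x \<ge> \<beta> \<Longrightarrow> s x = 0 \<and> s' x = 0" "\<And>x. e x \<le> \<alpha> \<Longrightarrow> s x = 1 \<and> s' x = 0"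
proof -
  define \<delta> where "\<delta> = (\<beta> - \<alpha>) / 4"
  have \<delta>: "\<delta> > 0" using \<alpha>\<beta> by (simp add: \<delta>_def)
  have \<delta>4: "4 * \<delta> = \<beta> - \<alpha>" by (simp add: \<delta>_def)
  obtain h :: "'a \<Rightarrow> real" and h' :: "'a \<Rightarrow> 'a \<Rightarrow>\<^sub>L real"
    where h: "\<And>x. (h has_derivative blinfun_apply (h' x)) (at x)"
      "continuous_on UNIV h'" "\<And>x. norm (h' x) \<le> L" "\<And>x. \<bar>h x - e x\<bar> \<le> \<delta>"
    using C1_lipschitz_approximation[OF e \<delta>] by blast
  define q where "q x = (\<beta> - \<delta> - h x) / (2 * \<delta>)" for x
  define s where "s x = step (q x)" for x
  define s' where "s' x = (step' (q x) * (- 1 / (2 * \<delta>))) *\<^sub>R h' x" for x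
  have q0: "q x \<le> 0" if "e x \<ge> \<beta>" for x
    using h(4)[of x] that \<delta> by (simp add: q_def divide_le_eq)
  have q1: "q x \<ge> 1" if "e x \<le> \<alpha>" for x
  proof -
    have "2 * \<delta> \<le> \<beta> - \<delta> - h x" using h(4)[of x] that \<delta>4 by linarith
    then show ?thesis using \<delta> by (simp add: q_def le_divide_eq)
  qed
  have L: "0 \<le> L" by (rule lipschitz_on_nonneg[OF e])
  show thesis
  proof (rule that[of s s' "4 * (1 / (2 * \<delta>)) * L + 1"])
    fix x
    have q': "(q has_derivative (\<lambda>y. - blinfun_apply (h' x) y / (2 * \<delta>))) (at x)"
      unfolding q_def[abs_def] using \<delta> by (auto intro!: derivative_eq_intros h(1))
    have s'_eq: "blinfun_apply (s' x) = (\<lambda>y. step' (q x) * (- blinfun_apply (h' x) y / (2 * \<delta>)))"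
      by (rule ext) (simp add: s'_def blinfun.scaleR_left blinfun.minus_left)
    from has_derivative_compose[OF q' step_deriv[unfolded has_field_derivative_def]]
    show "(s has_derivative blinfun_apply (s' x)) (at x)"
      unfolding s_def[abs_def] s'_eq .
    show "0 \<le> s x" "s x \<le> 1" by (simp_all add: s_def step_range)
    show "e x \<ge> \<beta> \<Longrightarrow> s x = 0 \<and> s' x = 0" "e x \<le> \<alpha> \<Longrightarrow> s x = 1 \<and> s' x = 0"
      using q0[of x] q1[of x] by (auto simp: s_def s'_def step_le_0 step'_le_0 step_ge_1)
    have "norm (s' x) = \<bar>step' (q x)\<bar> * (1 / (2 * \<delta>)) * norm (h' x)"
      using \<delta> by (simp add: s'_def abs_mult)
    also have "\<dots> \<le> 4 * (1 / (2 * \<delta>)) * L"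
      using \<delta> h(3)[of x] by (intro mult_mono step'_bound) auto
    finally show "norm (s' x) \<le> 4 * (1 / (2 * \<delta>)) * L + 1" by simp
  next
    have "continuous_on UNIV h"
      using h(1) by (meson continuous_at_imp_continuous_on has_derivative_continuous)
    then have "continuous_on UNIV q"
      unfolding q_def[abs_def] using \<delta> by (intro continuous_intros) auto
    from continuous_on_compose2[OF continuous_on_step'[of UNIV] this]
    show "continuous_on UNIV s'"
      unfolding s'_def[abs_def] by (intro continuous_intros h(2)) auto
    show "4 * (1 / (2 * \<delta>)) * L + 1 > 0" using \<delta> L by (simp add: add_nonneg_pos)
  qed
qed

section \<open>Gaining slack in the Lipschitz constant\<close>

text \<open>
  The maps \<open>t \<mapsto> t + c * (\<plusminus>2 - arctan t)\<close> stay within \<open>4 * c\<close> of the identity, one strictly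
  above it and one strictly below, and their slope \<open>1 - c / (1 + t\<^sup>2)\<close> is less than \<open>1\<close>, uniformly
  on bounded sets. Composed with \<open>U\<close>, they give a band around \<open>U\<close> whose edges have a Lipschitz
  constant smaller than \<open>K\<close> on every ball. Truncating the \<open>K'\<close>-Lipschitz function \<open>w\<close> to this band
  keeps the values where \<open>w\<close> and \<open>U\<close> agree.

  A convex combination of \<open>U\<close> and \<open>w\<close> would not do, because \<open>U - w\<close> may be unbounded.
\<close>

lemma locally_strict_lipschitz_perturbation:
  fixes U w :: "'a::real_normed_vector \<Rightarrow> real"
  assumes U: "K-lipschitz_on UNIV U" and w: "K'-lipschitz_on UNIV w" and KK: "K' < K"
    and \<epsilon>: "\<epsilon> > 0"
  obtains u where "\<And>x. \<bar>u x - U x\<bar> \<le> \<epsilon>" "\<And>x. w x = U x \<Longrightarrow> u x = U x"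
    "\<And>R. \<exists>L<K. L-lipschitz_on (cball 0 R) u"
proof -
  define c where "c = min 1 (\<epsilon> / 4)"
  have c: "0 < c" "c \<le> 1" "4 * c \<le> \<epsilon>" using \<epsilon> by (auto simp: c_def)
  define \<phi> where "\<phi> k t = t + c * (k - arctan t)" for k t :: real
  have \<phi>_deriv: "(\<phi> k has_real_derivative 1 - c / (1 + t\<^sup>2)) (at t)" for k t
    unfolding \<phi>_def[abs_def]
    by (auto intro!: derivative_eq_intros simp: field_simps add_nonneg_eq_0_iff)
  have arctan: "\<bar>arctan t\<bar> < 2" for t
    using arctan_bounded[of t] pi_less_4 by (simp add: abs_less_iff)
  have \<phi>_ord: "\<phi> (-2) t < t" "t < \<phi> 2 t" "t - \<epsilon> \<le> \<phi> (-2) t" "\<phi> 2 t \<le> t + \<epsilon>" for t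
  proof -
    have "c * (-2 - arctan t) < 0" "0 < c * (2 - arctan t)"
      using arctan[of t] c by (auto simp: mult_less_0_iff)
    moreover have "c * (2 - arctan t) \<le> c * 4" "c * (-4) \<le> c * (-2 - arctan t)"
      using arctan[of t] c by (intro mult_left_mono; simp)+
    ultimately show "\<phi> (-2) t < t" "t < \<phi> 2 t" "t - \<epsilon> \<le> \<phi> (-2) t" "\<phi> 2 t \<le> t + \<epsilon>"
      unfolding \<phi>_def using c by linarith+
  qed
  have \<phi>_contr: "\<bar>\<phi> k s - \<phi> k t\<bar> \<le> (1 - c / (1 + T\<^sup>2)) * \<bar>s - t\<bar>"
    if "\<bar>s\<bar> \<le> T" "\<bar>t\<bar> \<le> T" for k s t T
  proof -
    have "norm (\<phi> k s - \<phi> k t) \<le> (1 - c / (1 + T\<^sup>2)) * norm (s - t)"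
    proof (rule field_differentiable_bound[of "{-T..T}"])
      fix z assume z: "z \<in> {-T..T}"
      show "(\<phi> k has_real_derivative 1 - c / (1 + z\<^sup>2)) (at z within {-T..T})"
        by (rule has_field_derivative_at_within[OF \<phi>_deriv])
      have "z\<^sup>2 \<le> T\<^sup>2" using z by (auto intro!: abs_le_square_iff[THEN iffD1])
      then have "c / (1 + T\<^sup>2) \<le> c / (1 + z\<^sup>2)"
        using c by (intro divide_left_mono) (auto intro!: mult_pos_pos add_pos_nonneg)
      moreover have "c / (1 + z\<^sup>2) \<le> 1"
        using c by (subst divide_le_eq_1_pos) (auto intro!: add_pos_nonneg intro: order_trans)
      ultimately show "norm (1 - c / (1 + z\<^sup>2)) \<le> 1 - c / (1 + T\<^sup>2)" by simp
    qed (use that in auto)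
    then show ?thesis by simp
  qed
  have K: "0 \<le> K'" "0 < K" using lipschitz_on_nonneg[OF w] KK by auto
  define u where "u x = max (\<phi> (-2) (U x)) (min (w x) (\<phi> 2 (U x)))" for x
  show thesis
  proof (rule that[of u])
    fix x show "\<bar>u x - U x\<bar> \<le> \<epsilon>" "w x = U x \<Longrightarrow> u x = U x"
      using \<phi>_ord[of "U x"] by (auto simp: u_def max_def min_def)
  next
    fix R :: real
    define T where "T = \<bar>U 0\<bar> + K * \<bar>R\<bar>"
    define L where "L = max K' (K * (1 - c / (1 + T\<^sup>2)))"
    have "c / (1 + T\<^sup>2) > 0" using c by (intro divide_pos_pos add_pos_nonneg) auto
    then have "K * (1 - c / (1 + T\<^sup>2)) < K * 1" using K by (intro mult_strict_left_mono) auto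
    then have "L < K" using KK by (simp add: L_def)
    moreover have "L-lipschitz_on (cball 0 R) u"
    proof (rule lipschitz_onI)
      show "0 \<le> L" using K by (simp add: L_def)
      fix x y :: 'a assume xy: "x \<in> cball 0 R" "y \<in> cball 0 R"
      have bd: "\<bar>U z\<bar> \<le> T" if "z \<in> cball 0 R" for z
      proof -
        have "\<bar>U z - U 0\<bar> \<le> K * norm z"
          using lipschitz_onD[OF U, of z 0] by (simp add: dist_real_def)
        also have "\<dots> \<le> K * \<bar>R\<bar>" using that K by (intro mult_left_mono) auto
        finally show ?thesis by (simp add: T_def)
      qed
      have "\<bar>\<phi> k (U x) - \<phi> k (U y)\<bar> \<le> L * dist x y" for k
      proof -
        have "\<bar>\<phi> k (U x) - \<phi> k (U y)\<bar> \<le> (1 - c / (1 + T\<^sup>2)) * \<bar>U x - U y\<bar>"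
          by (rule \<phi>_contr[OF bd[OF xy(1)] bd[OF xy(2)]])
        also have "\<dots> \<le> (1 - c / (1 + T\<^sup>2)) * (K * dist x y)"
        proof (rule mult_left_mono)
          show "\<bar>U x - U y\<bar> \<le> K * dist x y"
            using lipschitz_onD[OF U, of x y] by (simp add: dist_real_def)
          show "0 \<le> 1 - c / (1 + T\<^sup>2)"
            using c by (simp add: divide_le_eq add_pos_nonneg add_increasing2)
        qed
        also have "\<dots> = (K * (1 - c / (1 + T\<^sup>2))) * dist x y" by simp
        also have "\<dots> \<le> L * dist x y" by (intro mult_right_mono) (auto simp: L_def)
        finally show ?thesis .
      qed
      from this[of "-2"] this[of 2] have "\<bar>\<phi> (-2) (U x) - \<phi> (-2) (U y)\<bar> \<le> L * dist x y"
        "\<bar>\<phi> 2 (U x) - \<phi> 2 (U y)\<bar> \<le> L * dist x y" .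
      moreover have "\<bar>w x - w y\<bar> \<le> L * dist x y"
      proof -
        have "\<bar>w x - w y\<bar> \<le> K' * dist x y"
          using lipschitz_onD[OF w, of x y] by (simp add: dist_real_def)
        also have "\<dots> \<le> L * dist x y" by (intro mult_right_mono) (auto simp: L_def)
        finally show ?thesis .
      qed
      ultimately show "dist (u x) (u y) \<le> L * dist x y"
        unfolding dist_real_def u_def by linarith
    qed
    ultimately show "\<exists>L<K. L-lipschitz_on (cball 0 R) u" by blast
  qed
qed

section \<open>Smoothing on an open set with prescribed values outside\<close>

text \<open>
  The sets \<open>{x. e x \<ge> r}\<close> with \<open>r > 0\<close> exhaust \<open>\<Omega>\<close>, are bounded, and keep away from the complement
  of \<open>\<Omega>\<close>. The constant \<open>2\<close> makes \<open>e\<close> smaller than \<open>1\<close>, so that the levels \<open>(1/2) ^ n\<close> start, at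
  \<open>n = 0\<close>, with the empty set.
\<close>

lemma lipschitz_exhaustion:
  fixes \<Omega> :: "'a::real_normed_vector set"
  assumes "open \<Omega>"
  obtains e :: "'a \<Rightarrow> real" where "1-lipschitz_on UNIV e" "\<And>x. 0 \<le> e x"
    "\<And>x. e x \<le> 1 / (2 + norm x)" "\<And>x. e x > 0 \<longleftrightarrow> x \<in> \<Omega>"
proof -
  define r where "r x = 1 / (2 + norm x)" for x :: 'a
  \<comment> \<open>By convention \<open>infdist\<close> to the empty set is \<open>0\<close>, so \<open>\<Omega> = UNIV\<close> needs its own value.\<close>
  define d where "d x = (if \<Omega> = UNIV then 1 else infdist x (- \<Omega>))" for x
  have r: "r x > 0" for x by (simp add: r_def add_pos_nonneg)
  have d: "d x \<ge> 0" "d x > 0 \<longleftrightarrow> x \<in> \<Omega>" for x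
    using in_closed_iff_infdist_zero[of "- \<Omega>" x] assms infdist_nonneg[of x "- \<Omega>"]
    by (auto simp: d_def less_le)
  have "\<bar>r x - r y\<bar> \<le> dist x y" for x y
  proof -
    have "\<bar>r x - r y\<bar> = \<bar>norm y - norm x\<bar> / ((2 + norm x) * (2 + norm y))"
      by (simp add: r_def diff_frac_eq add_nonneg_eq_0_iff abs_mult)
    also have "\<dots> \<le> \<bar>norm y - norm x\<bar> / 1"
    proof (rule divide_left_mono)
      have "1 * 1 \<le> (2 + norm x) * (2 + norm y)"
        by (rule mult_mono) (auto simp: add_increasing2)
      then show "1 \<le> (2 + norm x) * (2 + norm y)" by simp
    qed (auto intro!: mult_pos_pos add_pos_nonneg)
    also have "\<dots> \<le> dist x y"
      using norm_triangle_ineq3[of y x] by (simp add: dist_norm norm_minus_commute)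
    finally show ?thesis .
  qed
  moreover have "\<bar>d x - d y\<bar> \<le> dist x y" for x y
    using infdist_triangle_abs[of x "- \<Omega>" y] by (simp add: d_def)
  ultimately have "\<bar>min (d x) (r x) - min (d y) (r y)\<bar> \<le> dist x y" for x y
    by (smt (verit))
  then have "1-lipschitz_on UNIV (\<lambda>x. min (d x) (r x))"
    by (intro lipschitz_onI) (auto simp: dist_real_def)
  moreover have "min (d x) (r x) > 0 \<longleftrightarrow> x \<in> \<Omega>" "0 \<le> min (d x) (r x)"
    "min (d x) (r x) \<le> 1 / (2 + norm x)" for x
    using r[of x] d[of x] by (auto simp: r_def)
  ultimately show thesis by (intro that[of "\<lambda>x. min (d x) (r x)"])
qed

text \<open>
  On the ball of radius \<open>2 ^ Suc n\<close> the function \<open>u\<close> is \<open>L n\<close>-Lipschitz with \<open>L n < K\<close>. Extending this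
  restriction and regularizing gives a \<open>C\<^sup>1\<close> function \<open>v n\<close> with the constant \<open>L n\<close> and an error \<open>\<delta> n\<close>
  as small as desired. As \<open>e\<close> decreases through the band between \<open>(1/2) ^ n\<close> and \<open>(1/2) ^ Suc n\<close>,
  the partial blend \<open>V\<close> passes from \<open>v n\<close> to \<open>v (Suc n)\<close> by means of a cutoff. The gradient of the cutoff
  enters multiplied by \<open>v (Suc n) - v n\<close>, and \<open>\<delta>\<close> is chosen so small that this product fits into
  the slack \<open>K - L\<close>.

  The error is also kept below \<open>\<epsilon> * (e x)\<^sup>2\<close>. Being quadratic in the distance to the complement of
  \<open>\<Omega>\<close>, it does not contribute to the pointwise Lipschitz constant at points outside \<open>\<Omega>\<close>, which
  therefore is at most \<open>K\<close>, like that of \<open>u\<close>.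
\<close>

lemma C1_smoothing_on_open:
  fixes u :: "'a::real_inner \<Rightarrow> real"
  assumes \<Omega>: "open \<Omega>"
    and slack: "\<And>R. \<exists>L<K. L-lipschitz_on (cball 0 R) u"
    and \<epsilon>: "\<epsilon> > 0"
  obtains v where "C1_on \<Omega> v" "K-lipschitz_on UNIV v" "\<And>x. x \<notin> \<Omega> \<Longrightarrow> v x = u x"
    "\<And>x. \<bar>v x - u x\<bar> \<le> \<epsilon>"
proof -
  have "\<exists>L. L < K \<and> L-lipschitz_on (cball 0 (2 ^ Suc n)) u" for n using slack by blast
  then obtain L where L: "\<And>n. L n < K" and uL: "\<And>n. (L n)-lipschitz_on (cball 0 (2 ^ Suc n)) u"
    by metis
  have L0: "0 \<le> L n" for n by (rule lipschitz_on_nonneg[OF uL])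
  have K: "0 \<le> K" using L0[of 0] L[of 0] by simp
  have uK: "\<bar>u x - u y\<bar> \<le> K * norm (x - y)" for x y
  proof -
    obtain M where M: "M < K" "M-lipschitz_on (cball 0 (max (norm x) (norm y))) u"
      using slack by blast
    have "\<bar>u x - u y\<bar> \<le> M * norm (x - y)"
      using lipschitz_onD[OF M(2), of x y] by (simp add: dist_real_def dist_norm)
    also have "\<dots> \<le> K * norm (x - y)" using M(1) by (intro mult_right_mono) auto
    finally show ?thesis .
  qed
  obtain e :: "'a \<Rightarrow> real" where e_lip: "1-lipschitz_on UNIV e" and e0: "\<And>x. 0 \<le> e x"
    and e_le: "\<And>x. e x \<le> 1 / (2 + norm x)" and e_pos: "\<And>x. e x > 0 \<longleftrightarrow> x \<in> \<Omega>"
    using lipschitz_exhaustion[OF \<Omega>] by blast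
  have e1: "e x < 1" for x
  proof -
    have "1 / (2 + norm x) < 1" by (simp add: divide_less_eq add_pos_nonneg add_strict_increasing)
    then show ?thesis using e_le[of x] by linarith
  qed
  have "\<exists>s s' M. (\<forall>x. (s has_derivative blinfun_apply (s' x)) (at x)) \<and>
      continuous_on UNIV (s' :: 'a \<Rightarrow> 'a \<Rightarrow>\<^sub>L real) \<and> M > 0 \<and>
      (\<forall>x. norm (s' x) \<le> M \<and> 0 \<le> s x \<and> s x \<le> 1 \<and>
        (e x \<ge> (1/2) ^ n \<longrightarrow> s x = 0 \<and> s' x = 0) \<and>
        (e x \<le> (1/2) ^ Suc n \<longrightarrow> s x = 1 \<and> s' x = 0))" for n
  proof -
    have "(1/2::real) ^ Suc n < (1/2) ^ n" by simp
    from C1_cutoff[OF e_lip this] show ?thesis by metis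
  qed
  then obtain s s' M where
    s_all: "\<And>n. (\<forall>x. (s n has_derivative blinfun_apply (s' n x)) (at x)) \<and>
      continuous_on UNIV (s' n :: 'a \<Rightarrow> 'a \<Rightarrow>\<^sub>L real) \<and> M n > 0 \<and>
      (\<forall>x. norm (s' n x) \<le> M n \<and> 0 \<le> s n x \<and> s n x \<le> 1 \<and>
        (e x \<ge> (1/2) ^ n \<longrightarrow> s n x = 0 \<and> s' n x = 0) \<and>
        (e x \<le> (1/2) ^ Suc n \<longrightarrow> s n x = 1 \<and> s' n x = 0))"
    by metis
  then have s: "\<And>n x. (s n has_derivative blinfun_apply (s' n x)) (at x)"
      "\<And>n. continuous_on UNIV (s' n)" "\<And>n. M n > 0" "\<And>n x. norm (s' n x) \<le> M n"
      "\<And>n x. 0 \<le> s n x" "\<And>n x. s n x \<le> 1"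
    and s_out: "\<And>n x. e x \<ge> (1/2) ^ n \<Longrightarrow> s n x = 0 \<and> s' n x = 0"
    and s_in: "\<And>n x. e x \<le> (1/2) ^ Suc n \<Longrightarrow> s n x = 1 \<and> s' n x = 0"
    by blast+
  define \<tau> where "\<tau> n = min (K - L n) (K - L (Suc n)) / (2 * M n)" for n
  have \<tau>: "\<tau> n > 0" for n using L s(3)[of n] by (simp add: \<tau>_def)
  \<comment> \<open>Each \<open>v n\<close> takes part in the transitions \<open>n\<close> and \<open>n - 1\<close>, and its error must suit both. For
    \<open>n = 0\<close> the truncated difference repeats \<open>\<tau> 0\<close>.\<close>
  define \<delta> where "\<delta> n = min (min (\<tau> n) (\<tau> (n - 1))) (\<epsilon> / 4 ^ Suc n)" for n
  have \<delta>: "\<delta> n > 0" "\<delta> n \<le> \<tau> n" "\<delta> (Suc n) \<le> \<tau> n" "\<delta> n \<le> \<epsilon> / 4 ^ Suc n" for n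
    using \<tau> \<epsilon> by (auto simp: \<delta>_def)
  have "\<exists>w w'. (\<forall>x. (w has_derivative blinfun_apply (w' x)) (at x)) \<and>
      continuous_on UNIV (w' :: 'a \<Rightarrow> 'a \<Rightarrow>\<^sub>L real) \<and> (\<forall>x. norm (w' x) \<le> L n) \<and>
      (\<forall>x\<in>cball 0 (2 ^ Suc n). \<bar>w x - u x\<bar> \<le> \<delta> n)" for n
  proof -
    obtain U where U: "(L n)-lipschitz_on UNIV U" "\<And>x. x \<in> cball 0 (2 ^ Suc n) \<Longrightarrow> U x = u x"
      using lipschitz_extension[OF uL] by blast
    from C1_lipschitz_approximation[OF U(1) \<delta>(1)[of n]] U(2) show ?thesis by metis
  qed
  then obtain v v' where
    v_all: "\<And>n. (\<forall>x. (v n has_derivative blinfun_apply (v' n x)) (at x)) \<and>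
      continuous_on UNIV (v' n :: 'a \<Rightarrow> 'a \<Rightarrow>\<^sub>L real) \<and> (\<forall>x. norm (v' n x) \<le> L n) \<and>
      (\<forall>x\<in>cball 0 (2 ^ Suc n). \<bar>v n x - u x\<bar> \<le> \<delta> n)"
    by metis
  then have v: "\<And>n x. (v n has_derivative blinfun_apply (v' n x)) (at x)"
      "\<And>n. continuous_on UNIV (v' n)" "\<And>n x. norm (v' n x) \<le> L n"
    and v_u: "\<And>n x. norm x \<le> 2 ^ Suc n \<Longrightarrow> \<bar>v n x - u x\<bar> \<le> \<delta> n"
    by auto
  define V where "V n x = v 0 x + (\<Sum>k<n. s k x * (v (Suc k) x - v k x))" for n x
  define V' where "V' n x = v' 0 x + (\<Sum>k<n. s k x *\<^sub>R (v' (Suc k) x - v' k x) +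
    (v (Suc k) x - v k x) *\<^sub>R s' k x)" for n x
  have V_0: "V 0 x = v 0 x" "V' 0 x = v' 0 x" for x by (simp_all add: V_def V'_def)
  have V_Suc: "V (Suc n) x = V n x + s n x * (v (Suc n) x - v n x)"
    "V' (Suc n) x = V' n x + s n x *\<^sub>R (v' (Suc n) x - v' n x) + (v (Suc n) x - v n x) *\<^sub>R s' n x"
    for n x by (simp_all add: V_def V'_def)
  have V_deriv: "(V n has_derivative blinfun_apply (V' n x)) (at x)" for n x
  proof (induction n)
    case 0
    show ?case using v(1)[of 0 x] by (simp add: V_0[abs_def])
  next
    case (Suc n)
    show ?case
      unfolding V_Suc(1)[abs_def]
      by (rule has_derivative_eq_rhs[OF has_derivative_add[OF Suc
            has_derivative_mult[OF s(1) has_derivative_diff[OF v(1) v(1)]]]])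
        (auto simp: V_Suc(2) blinfun.add_left blinfun.diff_left blinfun.scaleR_left algebra_simps)
  qed
  have v_cont: "continuous_on UNIV (v n)" "continuous_on UNIV (s n)" for n
    using v(1) s(1) by (meson continuous_at_imp_continuous_on has_derivative_continuous)+
  have V'_cont: "continuous_on UNIV (V' n)" for n
    unfolding V'_def[abs_def] by (intro continuous_intros v(2) s(2) v_cont)
  have V_near: "V n x = v n x \<and> V' n x = v' n x" if "e x \<le> (1/2) ^ n" for n x
    using that
  proof (induction n)
    case (Suc n)
    then have "e x \<le> (1/2) ^ n" using e0[of x] by simp
    then show ?case using Suc s_in[of x n] by (simp add: V_Suc)
  qed (simp add: V_0)
  have V_far: "V (Suc n) x = V n x \<and> V' (Suc n) x = V' n x" if "e x \<ge> (1/2) ^ n" for n x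
    using s_out[OF that] by (simp add: V_Suc)
  \<comment> \<open>Where \<open>e\<close> is not too small, \<open>x\<close> lies in the ball on which \<open>v n\<close> and \<open>v (Suc n)\<close> approximate \<open>u\<close>.\<close>
  have band: "\<bar>v n x - u x\<bar> \<le> \<delta> n" "\<bar>v (Suc n) x - u x\<bar> \<le> \<delta> (Suc n)"
    if "(1/2) ^ Suc n \<le> e x" for n x
  proof -
    have "(1/2) ^ Suc n \<le> 1 / (2 + norm x)" using that e_le[of x] by linarith
    then have "inverse (2 ^ Suc n) \<le> inverse (2 + norm x)"
      by (simp only: inverse_eq_divide power_one_over)
    then have "2 + norm x \<le> 2 ^ Suc n" by (rule inverse_le_imp_le) (simp add: add_pos_nonneg)
    then have "norm x \<le> 2 ^ Suc n" by linarith
    moreover have "norm x \<le> 2 ^ Suc (Suc n)"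
      by (rule order_trans[OF \<open>norm x \<le> 2 ^ Suc n\<close>]) (intro power_increasing, auto)
    ultimately show "\<bar>v n x - u x\<bar> \<le> \<delta> n" "\<bar>v (Suc n) x - u x\<bar> \<le> \<delta> (Suc n)"
      by (auto intro!: v_u simp del: power_Suc)
  qed
  have V'_bound: "norm (V' n x) \<le> K" for n x
  proof (induction n)
    case 0
    show ?case using v(3)[of 0 x] L[of 0] by (simp add: V_0)
  next
    case (Suc n)
    consider "e x \<ge> (1/2) ^ n" | "e x \<le> (1/2) ^ Suc n" | "e x < (1/2) ^ n" "(1/2) ^ Suc n < e x"
      by linarith
    then show ?case
    proof cases
      case 1
      then show ?thesis using V_far Suc by simp
    next
      case 2
      then show ?thesis using V_near[of x "Suc n"] v(3)[of "Suc n" x] L[of "Suc n"] by simp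
    next
      case 3
      define m where "m = min (K - L n) (K - L (Suc n))"
      have "V' n x = v' n x" using V_near[of x n] 3 by simp
      then have "V' (Suc n) x = (1 - s n x) *\<^sub>R v' n x + s n x *\<^sub>R v' (Suc n) x
          + (v (Suc n) x - v n x) *\<^sub>R s' n x"
        by (simp add: V_Suc algebra_simps)
      also have "norm \<dots> \<le> norm ((1 - s n x) *\<^sub>R v' n x) + norm (s n x *\<^sub>R v' (Suc n) x)
          + norm ((v (Suc n) x - v n x) *\<^sub>R s' n x)"
        by (intro norm_triangle_le add_right_mono norm_triangle_ineq)
      also have "\<dots> = (1 - s n x) * norm (v' n x) + s n x * norm (v' (Suc n) x)
          + \<bar>v (Suc n) x - v n x\<bar> * norm (s' n x)"
        using s(5,6)[of n x] by simp
      also have "\<dots> \<le> (1 - s n x) * (K - m) + s n x * (K - m) + (2 * \<tau> n) * M n"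
      proof (intro add_mono mult_mono)
        show "norm (v' n x) \<le> K - m" "norm (v' (Suc n) x) \<le> K - m"
          using v(3)[of n x] v(3)[of "Suc n" x] by (auto simp: m_def)
        show "\<bar>v (Suc n) x - v n x\<bar> \<le> 2 * \<tau> n"
          using band[of n x] 3 \<delta>(2)[of n] \<delta>(3)[of n] by linarith
      qed (use s[of n] \<tau>[of n] in auto)
      also have "\<dots> = K"
        using s(3)[of n] by (simp add: \<tau>_def m_def algebra_simps)
      finally show ?thesis .
    qed
  qed
  have V_u: "\<bar>V n x - u x\<bar> \<le> \<epsilon> * (e x)\<^sup>2" if "(1/2) ^ n \<le> e x" for n x
    using that
  proof (induction n)
    case 0
    then show ?case using e1[of x] by simp
  next
    case (Suc n)
    show ?case
    proof (cases "(1/2) ^ n \<le> e x")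
      case True
      then show ?thesis using Suc V_far by simp
    next
      case False
      have "V n x = v n x" using V_near[of x n] False by simp
      then have "V (Suc n) x - u x = (1 - s n x) * (v n x - u x) + s n x * (v (Suc n) x - u x)"
        by (simp add: V_Suc algebra_simps)
      then have "\<bar>V (Suc n) x - u x\<bar> \<le> (1 - s n x) * \<bar>v n x - u x\<bar> + s n x * \<bar>v (Suc n) x - u x\<bar>"
        using abs_triangle_ineq[of "(1 - s n x) * (v n x - u x)" "s n x * (v (Suc n) x - u x)"]
          s(5,6)[of n x] by (simp add: abs_mult)
      also have "\<dots> \<le> (1 - s n x) * (\<epsilon> / 4 ^ Suc n) + s n x * (\<epsilon> / 4 ^ Suc n)"
      proof (intro add_mono mult_left_mono)
        show "\<bar>v n x - u x\<bar> \<le> \<epsilon> / 4 ^ Suc n"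
          using band(1)[OF Suc.prems] \<delta>(4)[of n] by linarith
        have "\<epsilon> / 4 ^ Suc (Suc n) \<le> \<epsilon> / 4 ^ Suc n" using \<epsilon> by (simp add: field_simps)
        then show "\<bar>v (Suc n) x - u x\<bar> \<le> \<epsilon> / 4 ^ Suc n"
          using band(2)[OF Suc.prems] \<delta>(4)[of "Suc n"] by linarith
      qed (use s(5,6)[of n x] in auto)
      also have "\<dots> = \<epsilon> * (1/4) ^ Suc n" 
        by (simp only: distrib_right[symmetric]) (simp add: power_one_over)
      also have "(1/4::real) = (1/2)\<^sup>2" by (simp add: power2_eq_square)
      also have "\<epsilon> * ((1/2)\<^sup>2) ^ Suc n = \<epsilon> * ((1/2) ^ Suc n)\<^sup>2"
        by (simp only: power_mult[symmetric] mult.commute)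
      also have "\<epsilon> * ((1/2) ^ Suc n)\<^sup>2 \<le> \<epsilon> * (e x)\<^sup>2"
        using Suc.prems \<epsilon> by (intro mult_left_mono power_mono) auto
      finally show ?thesis .
    qed
  qed
  have V_stable: "V n x = V m x \<and> V' n x = V' m x" if "(1/2) ^ m \<le> e x" "m \<le> n" for m n x
    using that(2)
  proof (induction n rule: dec_induct)
    case (step n)
    have "(1/2) ^ n \<le> e x"
      by (rule order_trans[OF power_decreasing that(1)]) (use step in auto)
    from V_far[OF this] show ?case using step by simp
  qed simp
  \<comment> \<open>At each point of \<open>\<Omega>\<close> the sequence \<open>V\<close> is eventually constant, locally uniformly. So its limit \<open>W\<close>
    inherits the smoothness and the bounds.\<close>
  define N where "N x = (LEAST n. (1/2) ^ n \<le> e x)" for x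
  define W where "W x = (if x \<in> \<Omega> then V (N x) x else u x)" for x
  define W' where "W' x = V' (N x) x" for x
  have W_eq: "W x = V n x \<and> W' x = V' n x" if n: "(1/2) ^ n \<le> e x" for n x
  proof -
    have "0 < (1/2::real) ^ n" by simp
    then have "x \<in> \<Omega>" using n e_pos[of x] by linarith
    moreover have "(1/2) ^ N x \<le> e x" unfolding N_def by (rule LeastI[of _ n]) (rule n)
    moreover have "N x \<le> n" unfolding N_def by (rule Least_le) (rule n)
    ultimately show ?thesis using V_stable[of "N x" x n] by (simp add: W_def W'_def)
  qed
  have ex_n: "\<exists>n. (1/2) ^ n < e x" if "x \<in> \<Omega>" for x
    using real_arch_pow_inv[of "e x" "1/2"] that e_pos by auto
  have e_cont: "continuous_on UNIV e" by (rule lipschitz_on_continuous_on[OF e_lip])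
  have op: "open {y. (1/2) ^ n < e y}" for n
    by (intro open_Collect_less continuous_on_const e_cont)
  have W_deriv: "(W has_derivative blinfun_apply (W' x)) (at x)" if x: "x \<in> \<Omega>" for x
  proof -
    obtain n where n: "(1/2) ^ n < e x" using ex_n[OF x] by blast
    have "(V n has_derivative blinfun_apply (W' x)) (at x)"
      using V_deriv[of n x] W_eq[of n x] n by simp
    then show ?thesis
    proof (rule has_derivative_transform_within_open[OF _ op[of n]])
      show "V n y = W y" if "y \<in> {y. (1/2) ^ n < e y}" for y using W_eq[of n y] that by simp
    qed (use n in simp)
  qed
  have W'_cont: "isCont W' x" if x: "x \<in> \<Omega>" for x
  proof -
    obtain n where n: "(1/2) ^ n < e x" using ex_n[OF x] by blast
    have "\<forall>\<^sub>F y in nhds x. W' y = V' n y"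
    proof (rule eventually_mono)
      show "\<forall>\<^sub>F y in nhds x. y \<in> {y. (1/2) ^ n < e y}"
        using eventually_nhds_in_open[OF op[of n], of x] n by simp
      show "W' y = V' n y" if "y \<in> {y. (1/2) ^ n < e y}" for y using W_eq[of n y] that by simp
    qed
    then have "isCont W' x \<longleftrightarrow> isCont (V' n) x" by (rule isCont_cong)
    then show ?thesis using V'_cont[of n] by (simp add: continuous_on_eq_continuous_at)
  qed
  have C1: "C1_on \<Omega> W"
    unfolding C1_on_def using W_deriv W'_cont
    by (intro exI[of _ W'] conjI ballI continuous_at_imp_continuous_on) auto
  have W'_bound: "norm (W' x) \<le> K" for x by (simp add: W'_def V'_bound)
  have W_u: "\<bar>W x - u x\<bar> \<le> \<epsilon> * (e x)\<^sup>2" for x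
  proof (cases "x \<in> \<Omega>")
    case True
    then obtain n where n: "(1/2) ^ n < e x" using ex_n by blast
    then show ?thesis using W_eq[of n x] V_u[of n x] by simp
  next
    case False
    then show ?thesis using \<epsilon> by (simp add: W_def)
  qed
  have "K-lipschitz_on UNIV W"
  proof (rule lipschitz_on_UNIV_pointwise[OF K])
    fix x :: 'a and \<eta> :: real assume \<eta>: "\<eta> > 0"
    show "\<exists>d>0. \<forall>y. norm (y - x) < d \<longrightarrow> \<bar>W y - W x\<bar> \<le> (K + \<eta>) * norm (y - x)"
    proof (cases "x \<in> \<Omega>")
      case True
      obtain d where d: "d > 0" "\<And>y. norm (y - x) < d \<Longrightarrow>
          norm (W y - W x - blinfun_apply (W' x) (y - x)) \<le> \<eta> * norm (y - x)"
        using W_deriv[OF True] \<eta> unfolding has_derivative_at_alt by blast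
      have "\<bar>W y - W x\<bar> \<le> (K + \<eta>) * norm (y - x)" if "norm (y - x) < d" for y
      proof -
        have "\<bar>blinfun_apply (W' x) (y - x)\<bar> \<le> norm (W' x) * norm (y - x)"
          using norm_blinfun[of "W' x" "y - x"] by simp
        also have "\<dots> \<le> K * norm (y - x)" by (intro mult_right_mono W'_bound) auto
        finally show ?thesis using d(2)[OF that] by (simp add: distrib_right)
      qed
      then show ?thesis using d(1) by blast
    next
      case False
      then have ex0: "e x = 0" using e0[of x] e_pos[of x] by (simp add: less_le)
      have "\<bar>W y - W x\<bar> \<le> (K + \<eta>) * norm (y - x)" if y: "norm (y - x) < \<eta> / \<epsilon>" for y
      proof -
        have "e y \<le> norm (y - x)"
          using lipschitz_onD[OF e_lip, of y x] ex0 e0[of y] by (simp add: dist_real_def dist_norm)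
        then have "(e y)\<^sup>2 \<le> (norm (y - x))\<^sup>2" using e0[of y] by (intro power_mono)
        then have "\<epsilon> * (e y)\<^sup>2 \<le> (\<epsilon> * norm (y - x)) * norm (y - x)"
          using \<epsilon> by (simp add: power2_eq_square mult.assoc)
        also have "\<dots> \<le> \<eta> * norm (y - x)"
          using y \<epsilon> by (intro mult_right_mono) (auto simp: field_simps)
        finally have "\<bar>W y - u y\<bar> \<le> \<eta> * norm (y - x)" using W_u[of y] by linarith
        moreover have "\<bar>u y - W x\<bar> \<le> K * norm (y - x)" using uK[of y x] False by (simp add: W_def)
        ultimately show ?thesis by (simp add: distrib_right)
      qed
      then show ?thesis using \<eta> \<epsilon> by (intro exI[of _ "\<eta> / \<epsilon>"]) auto
    qed
  qed
  moreover have "\<bar>W x - u x\<bar> \<le> \<epsilon>" for x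
  proof -
    have "\<epsilon> * (e x)\<^sup>2 \<le> \<epsilon> * 1"
      using \<epsilon> e0[of x] e1[of x] by (intro mult_left_mono power_le_one) auto
    then show ?thesis using W_u[of x] by simp
  qed
  ultimately show thesis using C1 by (intro that[of W]) (auto simp: W_def)
qed

section \<open>Approximation preserving boundary values\<close>

theorem theorem1p3:
  fixes \<Omega> :: "'a::{real_inner, complete_space} set"
    and u\<^sub>0 :: "'a \<Rightarrow> real"
    and \<epsilon> :: real
  assumes "open \<Omega>"
    and "\<exists>K. K-lipschitz_on (closure \<Omega>) u\<^sub>0"
    and "Lip u\<^sub>0 (frontier \<Omega>) < Lip u\<^sub>0 (closure \<Omega>)"
    and "\<epsilon> > 0"
  shows "\<exists>v :: 'a \<Rightarrow> real.
           C1_on \<Omega> v \<and>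
           (\<exists>K. K-lipschitz_on (closure \<Omega>) v) \<and>
           Lip v (closure \<Omega>) \<le> Lip u\<^sub>0 (closure \<Omega>) \<and>
           (\<forall>x\<in>frontier \<Omega>. v x = u\<^sub>0 x) \<and>
           (\<forall>x\<in>closure \<Omega>. \<bar>u\<^sub>0 x - v x\<bar> \<le> \<epsilon>)"
proof -
  let ?K = "Lip u\<^sub>0 (closure \<Omega>)" and ?K' = "Lip u\<^sub>0 (frontier \<Omega>)"
  have fr: "frontier \<Omega> \<subseteq> closure \<Omega>" "frontier \<Omega> \<inter> \<Omega> = {}"
    using assms(1) by (auto simp: frontier_def interior_open)
  obtain C where C: "C-lipschitz_on (closure \<Omega>) u\<^sub>0" using assms(2) by blast
  then have C': "C-lipschitz_on (frontier \<Omega>) u\<^sub>0" by (rule lipschitz_on_subset[OF _ fr(1)])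
  have K: "?K > 0" using Lip_nonneg[OF C'] assms(3) by linarith
  obtain U where U: "?K-lipschitz_on UNIV U" "\<And>x. x \<in> closure \<Omega> \<Longrightarrow> U x = u\<^sub>0 x"
    using lipschitz_extension[OF lipschitz_on_Lip[OF C]] by blast
  obtain w where w: "?K'-lipschitz_on UNIV w" "\<And>x. x \<in> frontier \<Omega> \<Longrightarrow> w x = u\<^sub>0 x"
    using lipschitz_extension[OF lipschitz_on_Lip[OF C']] by blast
  have \<epsilon>2: "\<epsilon> / 2 > 0" using assms(4) by simp
  obtain u where u: "\<And>x. \<bar>u x - U x\<bar> \<le> \<epsilon> / 2" "\<And>x. w x = U x \<Longrightarrow> u x = U x"
    "\<And>R. \<exists>L<?K. L-lipschitz_on (cball 0 R) u"
    using locally_strict_lipschitz_perturbation[OF U(1) w(1) assms(3) \<epsilon>2] by blast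
  obtain v where v: "C1_on \<Omega> v" "?K-lipschitz_on UNIV v" "\<And>x. x \<notin> \<Omega> \<Longrightarrow> v x = u x"
    "\<And>x. \<bar>v x - u x\<bar> \<le> \<epsilon> / 2"
    using C1_smoothing_on_open[OF assms(1) u(3) \<epsilon>2] by blast
  have v_lip: "?K-lipschitz_on (closure \<Omega>) v" by (rule lipschitz_on_subset[OF v(2)]) simp
  have "v x = u\<^sub>0 x" if x: "x \<in> frontier \<Omega>" for x
  proof -
    have "x \<in> closure \<Omega>" "x \<notin> \<Omega>" using x fr by blast+
    then show ?thesis using w(2)[OF x] U(2)[of x] v(3)[of x] u(2)[of x] by simp
  qed
  moreover have "\<bar>u\<^sub>0 x - v x\<bar> \<le> \<epsilon>" if x: "x \<in> closure \<Omega>" for x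
    using u(1)[of x] v(4)[of x] U(2)[OF x] by linarith
  ultimately show ?thesis
    using v(1) v_lip Lip_le[OF K v_lip] by blast
qed

end
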